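(* Let $F$ be a rational-infinitely divisible distribution function on $\mathbb{R}$ with characteristic function $f$, and let $c_d\in[0,1]$ be the weight of the discrete part of $F$ in its Lebesgue decomposition. If $c_d>0$, then $\inf_{t\in\mathbb{R}}|f(t)|>0$.
   Context: Distribution functions on $\mathbb{R}$ are (right-continuous) distribution functions of probability laws on $\mathbb{R}$. The characteristic function of $F$ is $f(t)=\int_{\mathbb{R}}e^{itx}\,dF(x)$, $t\in\mathbb{R}$. A distribution function $F$ is called rational-infinitely divisible if there exist infinitely divisible distribution functions $F_1$ and $F_2$ on $\mathbb{R}$ such that $F_1=F*F_2$, where $*$ denotes convolution; the class of all such $F$ is denoted $\boldsymbol{Q}$. By the Lebesgue decomposition, every distribution function can be written as $F(x)=c_dF_d(x)+(1-c_d)F_c(x)$, $x\in\mathbb{R}$, where $c_d\in[0,1]$, $F_d$ is a discrete distribution function (its law is concentrated on a countable set) and $F_c$ is a continuous distribution function; the number $c_d$ is uniquely determined by $F$ (it is the total mass of the atoms of $F$). *)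

theory Defs
  imports "HOL-Probability.Probability"
begin

text \<open>
  Distribution functions are functions on the reals. The law of a distribution function \<open>F\<close>
  is \<open>interval_measure F\<close>, the Lebesgue-Stieltjes measure of \<open>F\<close>; see \<open>law_of_cdf\<close> below.
\<close>

definition distribution_function :: "(real \<Rightarrow> real) \<Rightarrow> bool" where
  "distribution_function F \<longleftrightarrow> (\<exists>M. real_distribution M \<and> F = cdf M)"

lemma law_of_cdf:
  assumes "real_distribution M"
  shows "interval_measure (cdf M) = M"
proof -
  interpret real_distribution M by fact
  have *: "real_distribution (interval_measure (cdf M))"
    by (rule real_distribution_interval_measure)
      (auto intro: cdf_nondecreasing cdf_is_right_cont cdf_lim_at_bot cdf_lim_at_top_prob)
  have "cdf (interval_measure (cdf M)) = cdf M"
    by (rule cdf_interval_measure)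
      (auto intro: cdf_nondecreasing cdf_is_right_cont cdf_lim_at_bot cdf_lim_at_top_prob)
  with * assms show ?thesis
    by (intro cdf_unique)
qed

definition char_fun :: "(real \<Rightarrow> real) \<Rightarrow> real \<Rightarrow> complex" where
  "char_fun F = char (interval_measure F)"

definition df_convolution :: "(real \<Rightarrow> real) \<Rightarrow> (real \<Rightarrow> real) \<Rightarrow> real \<Rightarrow> real" where
  "df_convolution F G = cdf (interval_measure F \<star> interval_measure G)"

text \<open>
  The recursion starts from \<open>indicator {0..}\<close>, the distribution function of the point mass at \<open>0\<close>,
  which is the neutral element of convolution.
\<close>

primrec df_conv_power :: "(real \<Rightarrow> real) \<Rightarrow> nat \<Rightarrow> real \<Rightarrow> real" where
  "df_conv_power G 0 = indicator {0..}"
| "df_conv_power G (Suc n) = df_convolution G (df_conv_power G n)"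

definition infinitely_divisible :: "(real \<Rightarrow> real) \<Rightarrow> bool" where
  "infinitely_divisible F \<longleftrightarrow>
     distribution_function F \<and>
     (\<forall>n\<ge>1. \<exists>G. distribution_function G \<and> F = df_conv_power G n)"

definition rational_infinitely_divisible :: "(real \<Rightarrow> real) \<Rightarrow> bool" where
  "rational_infinitely_divisible F \<longleftrightarrow>
     distribution_function F \<and>
     (\<exists>F1 F2. infinitely_divisible F1 \<and> infinitely_divisible F2 \<and> F1 = df_convolution F F2)"

definition discrete_df :: "(real \<Rightarrow> real) \<Rightarrow> bool" where
  "discrete_df F \<longleftrightarrow>
     distribution_function F \<and> (\<exists>S. countable S \<and> measure (interval_measure F) S = 1)"

definition continuous_df :: "(real \<Rightarrow> real) \<Rightarrow> bool" where
  "continuous_df F \<longleftrightarrow> distribution_function F \<and> continuous_on UNIV F"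

end

theory Submission
  imports Defs "HOL-Real_Asymp.Real_Asymp"
begin

text \<open>
  The idea is to play off two facts about \<open>u t = \<bar>f t\<bar>\<^sup>2\<close> against each other: \<open>u\<close> cannot change
  abruptly, and \<open>u\<close> cannot stay small for long.

  For an infinitely divisible characteristic function, write \<open>f = g\<^sub>n ^ n\<close> and \<open>v\<^sub>n = \<bar>g\<^sub>n\<bar>\<^sup>2\<close>. As \<open>v\<^sub>n\<close>
  is the characteristic function of a symmetric law, its second differences satisfy
  \<open>\<bar>v\<^sub>n (s + h) + v\<^sub>n (s - h) - 2 v\<^sub>n s\<bar> \<le> 2 (1 - v\<^sub>n h)\<close>. Since \<open>n (1 - v\<^sub>n) \<longlonglongrightarrow> - ln u\<close>, the
  limit of \<open>n\<close> times this inequality bounds the second differences of \<open>ln u\<close> by \<open>- 2 ln (u h)\<close>,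
  independently of the place \<open>s\<close>; in multiplicative form,
  \<open>(u s)\<^sup>2 (u h)\<^sup>2 \<le> u (s + h) u (s - h)\<close> and \<open>u (s + h) u (s - h) (u h)\<^sup>2 \<le> (u s)\<^sup>2\<close>
  (\<open>infinitely_divisible_char_ratio\<close>). This replaces the Levy-Khintchine formula, from which the
  same bounds could be read off. If \<open>F\<^sub>1 = F * F\<^sub>2\<close>, then \<open>u = u\<^sub>1 / u\<^sub>2\<close> for the squared moduli
  \<open>u\<^sub>1\<close> and \<open>u\<^sub>2\<close> belonging to \<open>F\<^sub>1\<close> and \<open>F\<^sub>2\<close>, and dividing their bounds yields \<open>(u s)\<^sup>2 (u\<^sub>1 h)\<^sup>2 (u\<^sub>2 h)\<^sup>2 \<le> u (s + h) u (s - h)\<close>.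

  On the other hand, averaging \<open>exp (- i t x\<^sub>0) f t\<close> over \<open>[a, a + L]\<close> recovers the mass \<open>p\<close> of an atom
  \<open>x\<^sub>0\<close> of \<open>F\<close> as \<open>L\<close> tends to infinity, uniformly in \<open>a\<close>. So for a suitable \<open>L\<close> every interval
  of length \<open>L\<close> contains a point \<open>s\<close> with \<open>\<bar>f s\<bar> \<ge> p / 2\<close> (\<open>atom_imp_char_relatively_dense\<close>).

  Given \<open>t\<close>, choose such an \<open>s\<close> in \<open>[t, t + L]\<close> and put \<open>h = s - t\<close>. Then \<open>u (s - h) = u t\<close>, while
  \<open>u (s + h) \<le> 1\<close>, so \<open>u t \<ge> (p / 2) ^ 4 (u\<^sub>1 h)\<^sup>2 (u\<^sub>2 h)\<^sup>2\<close>, and the right-hand side is bounded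
  below for \<open>h\<close> in the compact interval \<open>[0, L]\<close>.
\<close>

section \<open>Convolutions and characteristic functions\<close>

lemma real_distribution_convolution:
  assumes "real_distribution M" "real_distribution N"
  shows "real_distribution (M \<star> N)"
proof -
  interpret M: real_distribution M by fact
  interpret N: real_distribution N by fact
  interpret P: pair_prob_space M N ..
  show ?thesis
    unfolding convolution_def by (rule P.real_distribution_distr) measurable
qed

lemma char_convolution:
  assumes "real_distribution M" "real_distribution N"
  shows "char (M \<star> N) t = char M t * char N t"
proof -
  interpret M: real_distribution M by fact
  interpret N: real_distribution N by fact
  interpret P: pair_prob_space M N ..
  have "integrable (M \<Otimes>\<^sub>M N) (\<lambda>z. iexp (t * fst z) * iexp (t * snd z))"
    by (intro P.integrable_const_bound[where B=1]) (auto simp: norm_mult)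
  from P.integral_fst'[OF this] show ?thesis
    unfolding char_def convolution_def
    by (simp add: integral_distr split_beta exp_add ring_distribs)
qed

lemma distribution_functionD:
  assumes "distribution_function F"
  shows "real_distribution (interval_measure F)" "cdf (interval_measure F) = F"
  using assms law_of_cdf unfolding distribution_function_def by auto

lemma distribution_function_cdf: "real_distribution M \<Longrightarrow> distribution_function (cdf M)"
  unfolding distribution_function_def by blast

lemma
  assumes "distribution_function F" "distribution_function G"
  shows distribution_function_df_convolution: "distribution_function (df_convolution F G)"
    and char_fun_df_convolution: "char_fun (df_convolution F G) t = char_fun F t * char_fun G t"
proof -
  note FG = assms[THEN distribution_functionD(1)]
  note conv = real_distribution_convolution[OF FG]
  show "distribution_function (df_convolution F G)"
    unfolding df_convolution_def by (rule distribution_function_cdf[OF conv])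
  show "char_fun (df_convolution F G) t = char_fun F t * char_fun G t"
    unfolding char_fun_def df_convolution_def law_of_cdf[OF conv] by (rule char_convolution[OF FG])
qed

lemma
  shows distribution_function_point_mass: "distribution_function (indicator {0..})"
    and char_fun_point_mass: "char_fun (indicator {0..}) t = 1"
proof -
  interpret prob_space "return borel (0::real)"
    by (rule prob_space_return) simp
  have *: "real_distribution (return borel (0::real))"
    by standard simp
  have **: "cdf (return borel (0::real)) = indicator {0..}"
    by (auto simp: cdf_def fun_eq_iff measure_return split: split_indicator)
  show "distribution_function (indicator {0..})"
    using distribution_function_cdf[OF *] ** by simp
  show "char_fun (indicator {0..}) t = 1"
    using law_of_cdf[OF *] ** by (simp add: char_fun_def char_def integral_return)
qed

lemma
  assumes "distribution_function G"
  shows distribution_function_df_conv_power: "distribution_function (df_conv_power G n)"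
    and char_fun_df_conv_power: "char_fun (df_conv_power G n) t = char_fun G t ^ n"
proof -
  have "distribution_function (df_conv_power G n) \<and> char_fun (df_conv_power G n) t = char_fun G t ^ n"
    by (induction n) (auto simp: distribution_function_point_mass char_fun_point_mass assms
        distribution_function_df_convolution char_fun_df_convolution)
  then show "distribution_function (df_conv_power G n)"
    "char_fun (df_conv_power G n) t = char_fun G t ^ n" by auto
qed

section \<open>Second differences of squared moduli\<close>

lemma Re_char:
  assumes "real_distribution M"
  shows "Re (char M t) = (\<integral>x. cos (t * x) \<partial>M)"
proof -
  interpret real_distribution M by fact
  have "integrable M (\<lambda>x. iexp (t * x))"
    by (intro integrable_const_bound[where B=1]) auto
  from integral_Re[OF this] show ?thesis
    by (simp add: char_def Re_exp)
qed

lemma cos_second_difference: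
  fixes a b :: real
  shows "\<bar>cos (a + b) + cos (a - b) - 2 * cos a\<bar> \<le> 2 * (1 - cos b)"
proof -
  have "cos (a + b) + cos (a - b) - 2 * cos a = 2 * (cos a * (cos b - 1))"
    by (simp add: cos_add cos_diff right_diff_distrib)
  moreover have "\<bar>2 * (cos a * (cos b - 1))\<bar> = 2 * (\<bar>cos a\<bar> * (1 - cos b))"
    by (simp add: abs_mult)
  moreover have "2 * (\<bar>cos a\<bar> * (1 - cos b)) \<le> 2 * (1 * (1 - cos b))"
    by (intro mult_left_mono mult_right_mono) auto
  ultimately show ?thesis
    by simp
qed

text \<open>The pointwise bound does not depend on \<open>s\<close>, and this survives integration.\<close>

lemma Re_char_second_difference:
  assumes "real_distribution M"
  shows "\<bar>Re (char M (s + h)) + Re (char M (s - h)) - 2 * Re (char M s)\<bar> \<le> 2 * (1 - Re (char M h))"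
proof -
  interpret real_distribution M by fact
  have [simp]: "integrable M (\<lambda>x. cos (r * x))" for r
    by (intro integrable_const_bound[where B=1]) auto
  have int: "integrable M (\<lambda>x. cos ((s + h) * x) + cos ((s - h) * x) - 2 * cos (s * x))"
    by (intro Bochner_Integration.integrable_diff Bochner_Integration.integrable_add
        integrable_mult_right) simp_all
  have eq: "Re (char M (s + h)) + Re (char M (s - h)) - 2 * Re (char M s)
      = (\<integral>x. cos ((s + h) * x) + cos ((s - h) * x) - 2 * cos (s * x) \<partial>M)"
    by (simp add: Re_char[OF assms])
  have "\<bar>\<integral>x. cos ((s + h) * x) + cos ((s - h) * x) - 2 * cos (s * x) \<partial>M\<bar>
      \<le> (\<integral>x. \<bar>cos ((s + h) * x) + cos ((s - h) * x) - 2 * cos (s * x)\<bar> \<partial>M)"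
    by (rule integral_abs_bound)
  also have "\<dots> \<le> (\<integral>x. 2 * (1 - cos (h * x)) \<partial>M)"
    using cos_second_difference[of "s * x" "h * x" for x]
    by (intro integral_mono integrable_abs int) (simp_all add: distrib_right left_diff_distrib)
  also have "\<dots> = 2 * (1 - Re (char M h))"
    by (simp add: Re_char[OF assms] prob_space[simplified])
  finally show ?thesis
    unfolding eq .
qed

text \<open>Symmetrization: \<open>\<bar>f\<bar>\<^sup>2\<close> is the characteristic function of \<open>X - X'\<close> for independent copies.\<close>

lemma cmod_char_power2_second_difference:
  fixes M :: "real measure"
  assumes "real_distribution M"
  defines "u \<equiv> \<lambda>t. (cmod (char M t))\<^sup>2"
  shows "\<bar>u (s + h) + u (s - h) - 2 * u s\<bar> \<le> 2 * (1 - u h)"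
proof -
  interpret real_distribution M by fact
  have N: "real_distribution (distr M borel uminus)"
    by simp
  have "char (distr M borel uminus) t = cnj (char M t)" for t
  proof -
    have "char (distr M borel uminus) t = (\<integral>x. cnj (iexp (t * x)) \<partial>M)"
      unfolding char_def by (subst integral_distr) (simp_all add: exp_cnj)
    also have "\<dots> = cnj (char M t)"
      unfolding char_def by (rule Bochner_Integration.integral_cnj)
    finally show ?thesis .
  qed
  then have "Re (char (M \<star> distr M borel uminus) t) = u t" for t
    by (simp add: char_convolution[OF assms(1) N] u_def complex_mult_cnj cmod_power2)
  then show ?thesis
    using Re_char_second_difference[OF real_distribution_convolution[OF assms(1) N], of s h] by simp
qed

section \<open>Infinitely divisible characteristic functions\<close>

text \<open>
  An abstract form of the passage to the logarithm. The function \<open>root n \<circ> u\<close> plays the part of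
  the squared modulus of the characteristic function of an \<open>n\<close>-th convolution root.
\<close>

locale root_second_difference =
  fixes u :: "real \<Rightarrow> real"
  assumes at_zero: "u 0 = 1"
    and cont: "continuous_on UNIV u"
    and second_difference: "1 \<le> n \<Longrightarrow>
      \<bar>root n (u (s + h)) + root n (u (s - h)) - 2 * root n (u s)\<bar> \<le> 2 * (1 - root n (u h))"
begin

text \<open>
  With \<open>s = h = t\<close> the assumption becomes \<open>root n (u (2 t)) \<ge> 4 root n (u t) - 3\<close>. If \<open>u t > 0\<close>, the
  \<open>n\<close>-th roots of \<open>u t\<close> tend to \<open>1\<close>, and the right-hand side is eventually positive.
\<close>

lemma pos_double:
  assumes "0 < u t"
  shows "0 < u (2 * t)"
proof -
  have "(\<lambda>n. root n (u t)) \<longlonglongrightarrow> 1"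
    by (rule LIMSEQ_root_const) fact
  from order_tendstoD(1)[OF this, of "3/4"]
  have "eventually (\<lambda>n. n \<ge> 1 \<and> root n (u t) > 3/4) sequentially"
    using eventually_ge_at_top[of "1::nat"] by (intro eventually_conj) auto
  then obtain n where n: "n \<ge> 1" "root n (u t) > 3/4"
    by (auto simp: eventually_sequentially)
  have "\<bar>root n (u (2 * t)) + 1 - 2 * root n (u t)\<bar> \<le> 2 * (1 - root n (u t))"
    using second_difference[OF n(1), of t t] n(1) by (simp add: at_zero)
  moreover have "w > 0" if "\<bar>w + 1 - 2 * v\<bar> \<le> 2 * (1 - v)" "v > 3/4" for v w :: real
    using that(2) abs_le_D2[OF that(1)] by argo
  ultimately have "root n (u (2 * t)) > 0"
    using n(2) by blast
  with n(1) show ?thesis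
    by simp
qed

text \<open>Halving \<open>t\<close> often enough leads into the neighbourhood of \<open>0\<close> where \<open>u\<close> is positive.\<close>

lemma pos: "0 < u t"
proof -
  have "isCont u 0"
    using cont by (simp add: continuous_on_eq_continuous_at)
  moreover have "(\<lambda>k. t / 2 ^ k) \<longlonglongrightarrow> 0"
    by real_asymp
  ultimately have "(\<lambda>k. u (t / 2 ^ k)) \<longlonglongrightarrow> u 0"
    by (rule isCont_tendsto_compose)
  from order_tendstoD(1)[OF this, of 0] obtain k where "0 < u (t / 2 ^ k)"
    by (auto simp: at_zero eventually_sequentially)
  moreover have "0 < u (2 ^ j * r)" if "0 < u r" for r j
  proof (induction j)
    case 0
    then show ?case
      using that by simp
  next
    case (Suc j)
    then show ?case
      using pos_double[of "2 ^ j * r"] by (simp add: mult.assoc)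
  qed
  ultimately have "0 < u (2 ^ k * (t / 2 ^ k))"
    by blast
  then show ?thesis
    by simp
qed

lemma ln_second_difference:
  "\<bar>ln (u (s + h)) + ln (u (s - h)) - 2 * ln (u s)\<bar> \<le> - 2 * ln (u h)"
proof -
  have lim: "(\<lambda>n. real n * (1 - root n (u t))) \<longlonglongrightarrow> - ln (u t)" for t
  proof (rule Lim_transform_eventually)
    show "(\<lambda>n. real n * (1 - u t powr (1 / real n))) \<longlonglongrightarrow> - ln (u t)"
      using pos[of t] by real_asymp
    show "eventually (\<lambda>n. real n * (1 - u t powr (1 / real n)) = real n * (1 - root n (u t))) sequentially"
      using eventually_ge_at_top[of "1::nat"]
      by eventually_elim (use pos[of t] in \<open>simp add: root_powr_inverse\<close>)
  qed
  define d where "d t n = real n * (1 - root n (u t))" for t n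
  have d: "d t \<longlonglongrightarrow> - ln (u t)" for t
    using lim[of t] by (simp add: d_def[abs_def])
  have "\<bar>- ln (u (s + h)) + - ln (u (s - h)) - 2 * - ln (u s)\<bar> \<le> 2 * - ln (u h)"
  proof (rule LIMSEQ_le)
    show "(\<lambda>n. \<bar>d (s + h) n + d (s - h) n - 2 * d s n\<bar>)
        \<longlonglongrightarrow> \<bar>- ln (u (s + h)) + - ln (u (s - h)) - 2 * - ln (u s)\<bar>"
      by (intro tendsto_intros d)
    show "(\<lambda>n. 2 * d h n) \<longlonglongrightarrow> 2 * - ln (u h)"
      by (intro tendsto_intros d)
    show "\<exists>N. \<forall>n\<ge>N. \<bar>d (s + h) n + d (s - h) n - 2 * d s n\<bar> \<le> 2 * d h n"
    proof (intro exI[of _ 1] allI impI)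
      fix n :: nat assume n: "1 \<le> n"
      have "d (s + h) n + d (s - h) n - 2 * d s n
          = - (real n * (root n (u (s + h)) + root n (u (s - h)) - 2 * root n (u s)))"
        by (simp add: d_def algebra_simps)
      then have "\<bar>d (s + h) n + d (s - h) n - 2 * d s n\<bar>
          = real n * \<bar>root n (u (s + h)) + root n (u (s - h)) - 2 * root n (u s)\<bar>"
        by (simp add: abs_mult)
      also have "\<dots> \<le> real n * (2 * (1 - root n (u h)))"
        by (intro mult_left_mono second_difference n) simp
      also have "\<dots> = 2 * d h n"
        by (simp add: d_def algebra_simps)
      finally show "\<bar>d (s + h) n + d (s - h) n - 2 * d s n\<bar> \<le> 2 * d h n" .
    qed
  qed
  then show ?thesis
    by linarith
qed

lemma product_bounds:
  shows "(u s)\<^sup>2 * (u h)\<^sup>2 \<le> u (s + h) * u (s - h)"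
    and "u (s + h) * u (s - h) * (u h)\<^sup>2 \<le> (u s)\<^sup>2"
proof -
  have "ln ((u s)\<^sup>2 * (u h)\<^sup>2) \<le> ln (u (s + h) * u (s - h))"
    "ln (u (s + h) * u (s - h) * (u h)\<^sup>2) \<le> ln ((u s)\<^sup>2)"
    using ln_second_difference[of s h] pos by (auto simp: ln_mult ln_realpow less_imp_neq[symmetric])
  then show "(u s)\<^sup>2 * (u h)\<^sup>2 \<le> u (s + h) * u (s - h)"
    "u (s + h) * u (s - h) * (u h)\<^sup>2 \<le> (u s)\<^sup>2"
    using pos by (auto simp: less_imp_neq[symmetric])
qed

end

lemma
  assumes "distribution_function F"
  shows continuous_cmod_char_fun: "continuous_on A (\<lambda>t. (cmod (char_fun F t))\<^sup>2)"
    and cmod_char_fun_le_1: "cmod (char_fun F t) \<le> 1"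
    and char_fun_zero: "char_fun F 0 = 1"
proof -
  interpret real_distribution "interval_measure F"
    by (rule distribution_functionD) fact
  show "continuous_on A (\<lambda>t. (cmod (char_fun F t))\<^sup>2)"
    unfolding char_fun_def
    by (intro continuous_intros continuous_at_imp_continuous_on ballI isCont_char)
  show "cmod (char_fun F t) \<le> 1" "char_fun F 0 = 1"
    by (simp_all add: char_fun_def cmod_char_le_1 char_zero)
qed

lemma infinitely_divisible_root_second_difference:
  assumes "infinitely_divisible F"
  shows "root_second_difference (\<lambda>t. (cmod (char_fun F t))\<^sup>2)"
proof
  have F: "distribution_function F"
    using assms by (simp add: infinitely_divisible_def)
  show "(cmod (char_fun F 0))\<^sup>2 = 1" "continuous_on UNIV (\<lambda>t. (cmod (char_fun F t))\<^sup>2)"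
    using F by (simp_all add: char_fun_zero continuous_cmod_char_fun)
  fix n :: nat and s h
  assume n: "1 \<le> n"
  then obtain G where G: "distribution_function G" "F = df_conv_power G n"
    using assms unfolding infinitely_divisible_def by blast
  have "(cmod (char_fun F t))\<^sup>2 = ((cmod (char_fun G t))\<^sup>2) ^ n" for t
    by (simp add: G(2) char_fun_df_conv_power[OF G(1)] norm_power mult.commute flip: power_mult)
  then have "root n ((cmod (char_fun F t))\<^sup>2) = (cmod (char_fun G t))\<^sup>2" for t
    using n by (simp add: real_root_power_cancel)
  then show "\<bar>root n ((cmod (char_fun F (s + h)))\<^sup>2) + root n ((cmod (char_fun F (s - h)))\<^sup>2)
      - 2 * root n ((cmod (char_fun F s))\<^sup>2)\<bar> \<le> 2 * (1 - root n ((cmod (char_fun F h))\<^sup>2))"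
    using cmod_char_power2_second_difference[OF distribution_functionD(1)[OF G(1)], of s h]
    by (simp add: char_fun_def)
qed

lemma infinitely_divisible_char_ratio:
  assumes "infinitely_divisible F"
  defines "u \<equiv> \<lambda>t. (cmod (char_fun F t))\<^sup>2"
  shows "0 < u t"
    and "(u s)\<^sup>2 * (u h)\<^sup>2 \<le> u (s + h) * u (s - h)"
    and "u (s + h) * u (s - h) * (u h)\<^sup>2 \<le> (u s)\<^sup>2"
proof -
  interpret root_second_difference u
    unfolding u_def by (rule infinitely_divisible_root_second_difference) fact
  show "0 < u t" "(u s)\<^sup>2 * (u h)\<^sup>2 \<le> u (s + h) * u (s - h)"
    "u (s + h) * u (s - h) * (u h)\<^sup>2 \<le> (u s)\<^sup>2"
    by (fact pos, fact product_bounds(1), fact product_bounds(2))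
qed

lemma infinitely_divisible_char_bounded_below:
  assumes "infinitely_divisible F" "0 \<le> L"
  shows "\<exists>m>0. \<forall>h\<in>{0..L}. m \<le> (cmod (char_fun F h))\<^sup>2"
proof -
  have "distribution_function F"
    using assms by (simp add: infinitely_divisible_def)
  then obtain x where "\<forall>h\<in>{0..L}. (cmod (char_fun F x))\<^sup>2 \<le> (cmod (char_fun F h))\<^sup>2"
    using continuous_attains_inf[OF compact_Icc _ continuous_cmod_char_fun, of 0 L F] assms(2) by auto
  then show ?thesis
    using infinitely_divisible_char_ratio(1)[OF assms(1), of x]
    by (intro exI[of _ "(cmod (char_fun F x))\<^sup>2"]) simp
qed

section \<open>Atoms and the size of the characteristic function\<close>

lemma real_distribution_uniform: "real_distribution (uniform_measure lborel {0..1::real})"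
proof -
  interpret prob_space "uniform_measure lborel {0..1::real}"
    by (rule prob_space_uniform_measure) auto
  show ?thesis
    by standard simp
qed

lemma cmod_char_uniform_le:
  assumes "s \<noteq> 0"
  shows "cmod (char (uniform_measure lborel {0..1}) s) \<le> 2 / \<bar>s\<bar>"
proof -
  have "char (uniform_measure lborel {0..1}) s = (\<integral>x. indicator {0..1} x *\<^sub>R iexp (s * x) \<partial>lborel)"
    unfolding char_def uniform_measure_def
    by (subst integral_density[symmetric]) (auto simp: divide_ennreal_def simp flip: ennreal_indicator)
  also have "\<dots> = iexp (s * 1) / (\<i> * s) - iexp (s * 0) / (\<i> * s)"
  proof (rule integral_FTC_Icc)
    fix x :: real
    have "((\<lambda>x. exp (x *\<^sub>R (\<i> * s))) has_vector_derivative exp (x *\<^sub>R (\<i> * s)) * (\<i> * s)) (at x within {0..1})"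
      by (rule exp_scaleR_has_vector_derivative_right)
    from has_vector_derivative_divide[OF this, of "\<i> * s"]
    show "((\<lambda>x. iexp (s * x) / (\<i> * s)) has_vector_derivative iexp (s * x)) (at x within {0..1})"
      using assms by (simp add: scaleR_conv_of_real mult_ac)
  qed (auto intro!: continuous_intros)
  also have "cmod \<dots> \<le> cmod (iexp (s * 1) / (\<i> * s)) + cmod (iexp (s * 0) / (\<i> * s))"
    by (rule norm_triangle_ineq4)
  also have "\<dots> = 2 / \<bar>s\<bar>"
    by (simp add: norm_divide norm_mult)
  finally show ?thesis .
qed

lemma char_uniform_scaled_tendsto:
  "(\<lambda>n. char (uniform_measure lborel {0..1}) (real n * y)) \<longlonglongrightarrow> indicator {0} y"
proof (cases "y = 0")
  case True
  then show ?thesis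
    using real_distribution.char_zero[OF real_distribution_uniform] by simp
next
  case False
  have "(\<lambda>n. char (uniform_measure lborel {0..1}) (real n * y)) \<longlonglongrightarrow> 0"
  proof (rule Lim_null_comparison)
    show "eventually (\<lambda>n. cmod (char (uniform_measure lborel {0..1}) (real n * y)) \<le> 2 / \<bar>real n * y\<bar>) sequentially"
      using eventually_gt_at_top[of 0]
      by eventually_elim (use False in \<open>auto intro: cmod_char_uniform_le\<close>)
    have "0 < \<bar>y\<bar>"
      using False by simp
    then have "(\<lambda>n. 2 / (real n * \<bar>y\<bar>)) \<longlonglongrightarrow> 0"
      by real_asymp
    then show "(\<lambda>n. 2 / \<bar>real n * y\<bar>) \<longlonglongrightarrow> 0"
      by (simp add: abs_mult)
  qed
  with False show ?thesis
    by simp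
qed

text \<open>
  The factor \<open>iexp (- ((a + l v) * x0))\<close> turns the atom at \<open>x0\<close> into the constant term of the mean.
  After exchanging the integrals, the position \<open>a\<close> of the window survives only in a factor of
  modulus \<open>1\<close>; this is the source of the uniformity in \<open>a\<close> below.
\<close>

lemma window_average_char:
  fixes M :: "real measure" and a l x0 :: real
  assumes "real_distribution M"
  defines "U \<equiv> uniform_measure lborel {0..1::real}"
  shows "(\<integral>v. iexp (- ((a + l * v) * x0)) * char M (a + l * v) \<partial>U)
       = (\<integral>x. iexp (a * (x - x0)) * char U (l * (x - x0)) \<partial>M)"
proof -
  interpret M: real_distribution M by fact
  interpret U: real_distribution U
    unfolding U_def by (rule real_distribution_uniform)
  interpret P: pair_prob_space M U ..
  have "integrable (M \<Otimes>\<^sub>M U) (\<lambda>(x, v). iexp ((a + l * v) * (x - x0)))"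
    by (intro P.integrable_const_bound[where B=1]) (auto simp: split_beta)
  from P.Fubini_integral[OF this]
  have "(\<integral>v. (\<integral>x. iexp ((a + l * v) * (x - x0)) \<partial>M) \<partial>U) = (\<integral>x. (\<integral>v. iexp ((a + l * v) * (x - x0)) \<partial>U) \<partial>M)"
    by simp
  moreover have "(\<integral>x. iexp ((a + l * v) * (x - x0)) \<partial>M) = iexp (- ((a + l * v) * x0)) * char M (a + l * v)" for v
    unfolding char_def integral_mult_right_zero[symmetric]
    by (intro Bochner_Integration.integral_cong) (auto simp: algebra_simps simp flip: exp_add)
  moreover have "(\<integral>v. iexp ((a + l * v) * (x - x0)) \<partial>U) = iexp (a * (x - x0)) * char U (l * (x - x0))" for x
    unfolding char_def integral_mult_right_zero[symmetric]
    by (intro Bochner_Integration.integral_cong) (auto simp: algebra_simps simp flip: exp_add)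
  ultimately show ?thesis
    by simp
qed

text \<open>
  A window on which \<open>\<bar>f\<bar>\<close> stays below \<open>p / 2\<close> has a mean of modulus at most \<open>p / 2\<close>, whereas for a
  long window every mean is within less than \<open>p / 2\<close> of the mass \<open>p\<close> of the atom.
\<close>

lemma atom_imp_char_relatively_dense:
  assumes "real_distribution M" "measure M {x0} > 0"
  shows "\<exists>L\<ge>0. \<forall>a. \<exists>s\<in>{a..a + L}. measure M {x0} / 2 \<le> cmod (char M s)"
proof -
  interpret M: real_distribution M by fact
  define U where "U = uniform_measure lborel {0..1::real}"
  interpret U: real_distribution U
    unfolding U_def by (rule real_distribution_uniform)
  define p where "p = measure M {x0}"
  define k where "k n x = char U (real n * (x - x0)) - indicator {x0} x" for n x
  have k_meas [measurable]: "k n \<in> borel_measurable borel" for n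
  proof -
    have "(\<lambda>x. char U (real n * (x - x0))) \<in> borel_measurable borel"
      using measurable_compose[OF _ U.char_measurable] by measurable
    then show ?thesis
      unfolding k_def[abs_def] by measurable
  qed
  have k_le: "cmod (k n x) \<le> 2" for n x
    using norm_triangle_ineq4[of "char U (real n * (x - x0))" "indicator {x0} x"]
      U.cmod_char_le_1[of "real n * (x - x0)"]
    by (auto simp: k_def split: split_indicator_asm)
  have k_lim: "(\<lambda>n. k n x) \<longlonglongrightarrow> 0" for x
  proof -
    have "(\<lambda>n. k n x) \<longlonglongrightarrow> indicator {0} (x - x0) - indicator {x0} x"
      unfolding k_def U_def by (intro tendsto_intros char_uniform_scaled_tendsto)
    then show ?thesis
      by (simp add: indicator_def)
  qed
  have "(\<lambda>n. \<integral>x. cmod (k n x) \<partial>M) \<longlonglongrightarrow> (\<integral>x. 0 \<partial>M)"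
    by (rule integral_dominated_convergence[where w="\<lambda>_. 2"])
      (auto simp: k_le intro!: tendsto_norm_zero k_lim)
  from order_tendstoD(2)[OF this, of "p / 2"] obtain n where n: "(\<integral>x. cmod (k n x) \<partial>M) < p / 2"
    using assms(2) by (auto simp: p_def eventually_sequentially)
  have "\<exists>s\<in>{a..a + real n}. p / 2 \<le> cmod (char M s)" for a
  proof (rule ccontr)
    assume "\<not> ?thesis"
    then have small: "cmod (char M s) \<le> p / 2" if "s \<in> {a..a + real n}" for s
      using that by force
    define A where "A = (\<integral>v. iexp (- ((a + real n * v) * x0)) * char M (a + real n * v) \<partial>U)"
    have char_M_meas [measurable]: "(\<lambda>v. char M (a + real n * v)) \<in> borel_measurable borel"
      using measurable_compose[OF _ M.char_measurable] by measurable
    have "AE v in U. v \<in> {0..1}"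
      unfolding U_def by (rule AE_uniform_measureI) auto
    then have "AE v in U. cmod (iexp (- ((a + real n * v) * x0)) * char M (a + real n * v)) \<le> p / 2"
    proof eventually_elim
      fix v :: real assume "v \<in> {0..1}"
      then have "a + real n * v \<in> {a..a + real n}"
        using mult_left_mono[of v 1 "real n"] by auto
      from small[OF this]
      show "cmod (iexp (- ((a + real n * v) * x0)) * char M (a + real n * v)) \<le> p / 2"
        by (simp add: norm_mult del: of_real_minus)
    qed
    then have "(\<integral>v. cmod (iexp (- ((a + real n * v) * x0)) * char M (a + real n * v)) \<partial>U) \<le> (\<integral>v. p / 2 \<partial>U)"
      using assms(2)
      by (intro integral_mono_AE U.integrable_const_bound[where B="p / 2"]) (auto simp: p_def)
    then have A_le: "cmod A \<le> p / 2"
      unfolding A_def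
      by (intro order_trans[OF integral_norm_bound]) (simp add: U.prob_space[simplified])
    have "A = (\<integral>x. iexp (a * (x - x0)) * char U (real n * (x - x0)) \<partial>M)"
      unfolding A_def U_def by (rule window_average_char) fact
    also have "\<dots> = (\<integral>x. iexp (a * (x - x0)) * k n x + indicator {x0} x \<partial>M)"
      by (intro Bochner_Integration.integral_cong) (auto simp: k_def algebra_simps split: split_indicator)
    also have "\<dots> = (\<integral>x. iexp (a * (x - x0)) * k n x \<partial>M) + (\<integral>x. indicator {x0} x \<partial>M)"
      by (intro Bochner_Integration.integral_add M.integrable_const_bound[where B=2])
        (auto simp: norm_mult k_le split: split_indicator simp del: of_real_diff)
    also have "(\<integral>x. indicator {x0} x \<partial>M) = complex_of_real p"
    proof -
      have "(\<integral>x. indicator {x0} x \<partial>M) = (\<integral>x. complex_of_real (indicator {x0} x) \<partial>M)"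
        by (intro Bochner_Integration.integral_cong) (auto split: split_indicator)
      then show ?thesis
        by (simp add: p_def)
    qed
    finally have "p = A - (\<integral>x. iexp (a * (x - x0)) * k n x \<partial>M)"
      by simp
    then have "cmod p \<le> cmod A + cmod (\<integral>x. iexp (a * (x - x0)) * k n x \<partial>M)"
      by (metis norm_triangle_ineq4)
    also have "cmod (\<integral>x. iexp (a * (x - x0)) * k n x \<partial>M) \<le> (\<integral>x. cmod (iexp (a * (x - x0)) * k n x) \<partial>M)"
      by (rule integral_norm_bound)
    also have "\<dots> = (\<integral>x. cmod (k n x) \<partial>M)"
      by (simp add: norm_mult del: of_real_diff)
    finally show False
      using A_le n by (simp add: p_def)
  qed
  then show ?thesis
    unfolding p_def by (intro exI[of _ "real n"]) auto
qed

lemma discrete_df_has_atom: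
  assumes "discrete_df F"
  shows "\<exists>x. measure (interval_measure F) {x} > 0"
proof (rule ccontr)
  assume "\<not> ?thesis"
  then have null: "measure (interval_measure F) {x} = 0" for x
    by (metis measure_nonneg less_eq_real_def)
  obtain S where S: "countable S" "measure (interval_measure F) S = 1"
    using assms unfolding discrete_df_def by blast
  interpret real_distribution "interval_measure F"
    using assms by (intro distribution_functionD) (simp add: discrete_df_def)
  have "emeasure (interval_measure F) S = (\<integral>\<^sup>+x. emeasure (interval_measure F) {x} \<partial>count_space S)"
    using S(1) by (intro emeasure_countable_singleton) auto
  also have "\<dots> = 0"
    by (simp add: emeasure_eq_measure null)
  finally show False
    using S(2) by (simp add: measure_def)
qed

text \<open>Atoms are the jumps of the distribution function, and a continuous summand removes no jump.\<close>

lemma discrete_part_imp_atom: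
  assumes "distribution_function F" "discrete_df Fd" "continuous_df Fc"
    and eq: "\<And>x. F x = c * Fd x + (1 - c) * Fc x" and "c > 0"
  shows "\<exists>x. measure (interval_measure F) {x} > 0"
proof -
  have Fd: "distribution_function Fd"
    using assms by (simp add: discrete_df_def)
  interpret F: real_distribution "interval_measure F"
    by (rule distribution_functionD) fact
  interpret Fd: real_distribution "interval_measure Fd"
    by (rule distribution_functionD) fact
  obtain x where x: "measure (interval_measure Fd) {x} > 0"
    using discrete_df_has_atom[OF assms(2)] by blast
  have "measure (interval_measure F) {x} \<noteq> 0"
  proof
    assume "measure (interval_measure F) {x} = 0"
    then have "isCont F x"
      using F.isCont_cdf[of x] by (simp add: distribution_functionD assms(1))
    moreover have "isCont Fc x"
      using assms(3) by (simp add: continuous_df_def continuous_on_eq_continuous_at)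
    ultimately have "isCont (\<lambda>x. (F x - (1 - c) * Fc x) / c) x"
      using \<open>c > 0\<close> by (intro continuous_intros) auto
    also have "(\<lambda>x. (F x - (1 - c) * Fc x) / c) = Fd"
      using \<open>c > 0\<close> by (simp add: eq fun_eq_iff)
    finally show False
      using Fd.isCont_cdf[of x] x by (simp add: distribution_functionD Fd)
  qed
  then show ?thesis
    by (metis measure_nonneg less_eq_real_def)
qed

section \<open>The lower bound\<close>

text \<open>
  For the factor \<open>F2\<close>, which is divided out, it is the upper bound on \<open>u2 (s + h) u2 (s - h)\<close> that
  counts.
\<close>

lemma rational_infinitely_divisible_product_lower_bound:
  assumes F: "distribution_function F"
    and "infinitely_divisible F1" "infinitely_divisible F2" "F1 = df_convolution F F2"
  defines "u \<equiv> \<lambda>t. (cmod (char_fun F t))\<^sup>2"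
    and "u1 \<equiv> \<lambda>t. (cmod (char_fun F1 t))\<^sup>2"
    and "u2 \<equiv> \<lambda>t. (cmod (char_fun F2 t))\<^sup>2"
  shows "(u s)\<^sup>2 * (u1 h)\<^sup>2 * (u2 h)\<^sup>2 \<le> u (s + h) * u (s - h)"
proof -
  have "distribution_function F2"
    using assms by (simp add: infinitely_divisible_def)
  then have u1: "u1 t = u t * u2 t" for t
    using F by (simp add: u_def u1_def u2_def assms(4) char_fun_df_convolution norm_mult power_mult_distrib)
  have lower: "(u1 s)\<^sup>2 * (u1 h)\<^sup>2 \<le> u1 (s + h) * u1 (s - h)"
    unfolding u1_def by (rule infinitely_divisible_char_ratio) fact
  have upper: "u2 (s + h) * u2 (s - h) * (u2 h)\<^sup>2 \<le> (u2 s)\<^sup>2"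
    unfolding u2_def by (rule infinitely_divisible_char_ratio) fact
  have pos: "0 < u2 s"
    unfolding u2_def by (rule infinitely_divisible_char_ratio) fact
  have "0 \<le> u t" for t
    by (simp add: u_def)
  have "(u s)\<^sup>2 * (u1 h)\<^sup>2 * (u2 h)\<^sup>2 * (u2 s)\<^sup>2 = (u1 s)\<^sup>2 * (u1 h)\<^sup>2 * (u2 h)\<^sup>2"
    by (simp add: u1[of s] power_mult_distrib mult_ac)
  also have "\<dots> \<le> u1 (s + h) * u1 (s - h) * (u2 h)\<^sup>2"
    by (intro mult_right_mono lower) auto
  also have "\<dots> = u (s + h) * u (s - h) * (u2 (s + h) * u2 (s - h) * (u2 h)\<^sup>2)"
    by (simp add: u1 mult_ac)
  also have "\<dots> \<le> u (s + h) * u (s - h) * (u2 s)\<^sup>2"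
    using \<open>\<And>t. 0 \<le> u t\<close> by (intro mult_left_mono upper) auto
  finally show ?thesis
    using pos by (simp add: mult_le_cancel_right)
qed

theorem theorem1:
  fixes F F\<^sub>d F\<^sub>c :: "real \<Rightarrow> real" and c\<^sub>d :: real
  assumes "rational_infinitely_divisible F"
    and "c\<^sub>d \<in> {0..1}"
    and "discrete_df F\<^sub>d"
    and "continuous_df F\<^sub>c"
    and "\<And>x. F x = c\<^sub>d * F\<^sub>d x + (1 - c\<^sub>d) * F\<^sub>c x"
    and "c\<^sub>d > 0"
  shows "(INF t. cmod (char_fun F t)) > 0"
proof -
  obtain F1 F2 where F: "distribution_function F" and F12: "infinitely_divisible F1"
    "infinitely_divisible F2" "F1 = df_convolution F F2"
    using assms(1) unfolding rational_infinitely_divisible_def by blast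
  obtain x where x: "measure (interval_measure F) {x} > 0"
    using discrete_part_imp_atom[OF F assms(3-6)] by blast
  define p where "p = measure (interval_measure F) {x}"
  have p: "p > 0"
    using x by (simp add: p_def)
  from atom_imp_char_relatively_dense[OF distribution_functionD(1)[OF F] x]
  obtain L where L: "L \<ge> 0" "\<And>a. \<exists>s\<in>{a..a + L}. p / 2 \<le> cmod (char_fun F s)"
    unfolding p_def char_fun_def by blast
  obtain m1 where m1: "m1 > 0" "\<And>h. h \<in> {0..L} \<Longrightarrow> m1 \<le> (cmod (char_fun F1 h))\<^sup>2"
    using infinitely_divisible_char_bounded_below[OF F12(1) L(1)] by blast
  obtain m2 where m2: "m2 > 0" "\<And>h. h \<in> {0..L} \<Longrightarrow> m2 \<le> (cmod (char_fun F2 h))\<^sup>2"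
    using infinitely_divisible_char_bounded_below[OF F12(2) L(1)] by blast
  define b where "b = ((p / 2)\<^sup>2)\<^sup>2 * m1\<^sup>2 * m2\<^sup>2"
  have b: "b > 0"
    using p m1 m2 by (simp add: b_def)
  have lower: "sqrt b \<le> cmod (char_fun F t)" for t
  proof -
    obtain s where s: "s \<in> {t..t + L}" "p / 2 \<le> cmod (char_fun F s)"
      using L(2) by blast
    define h where "h = s - t"
    have h: "h \<in> {0..L}"
      using s by (auto simp: h_def)
    have "b \<le> ((cmod (char_fun F s))\<^sup>2)\<^sup>2 * ((cmod (char_fun F1 h))\<^sup>2)\<^sup>2 * ((cmod (char_fun F2 h))\<^sup>2)\<^sup>2"
      unfolding b_def using p m1 m2 s(2) h by (intro mult_mono power_mono) auto
    also have "\<dots> \<le> (cmod (char_fun F (s + h)))\<^sup>2 * (cmod (char_fun F (s - h)))\<^sup>2"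
      by (rule rational_infinitely_divisible_product_lower_bound[OF F F12])
    also have "\<dots> \<le> 1 * (cmod (char_fun F (s - h)))\<^sup>2"
      by (intro mult_right_mono) (auto simp: power_le_one cmod_char_fun_le_1[OF F])
    finally show ?thesis
      by (simp add: h_def real_le_lsqrt)
  qed
  have "0 < sqrt b"
    using b by simp
  also have "\<dots> \<le> (INF t. cmod (char_fun F t))"
    by (rule cINF_greatest) (auto simp: lower)
  finally show ?thesis .
qed

end
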